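(* Let $n\geq 2$ be an integer and let $A\subset\mathbb{R}^n$ be nonempty and compact. Then $$d(A(n))\leq \left(1-\frac{n-1}{n(2n-1)}\right)d(A).$$
   Context: For sets $A,B\subset\mathbb{R}^n$, the Minkowski sum is $A+B:=\{a+b:a\in A,\,b\in B\}$. For a positive integer $k$, the iterated Minkowski average is $A(k):=\frac1k(\underbrace{A+\dots+A}_{k\text{ times}})=\left\{\frac{a_1+\dots+a_k}{k}: a_1,\dots,a_k\in A\right\}$; in particular $A(n)$ is the case where $k=n$ equals the dimension of the ambient space. The convex hull of $A$ is denoted $\operatorname{co}(A)$. For a nonempty compact set $A\subset\mathbb{R}^n$, $d(A)$ denotes the Hausdorff distance between $A$ and its convex hull with respect to the Euclidean norm: $$d(A):=\sup_{x\in\operatorname{co}(A)}\inf_{y\in A}\|x-y\|_2.$$ *)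

theory Defs
  imports "HOL-Analysis.Analysis"
begin

definition minkowski_average :: "'a::real_vector set \<Rightarrow> nat \<Rightarrow> 'a set" where
  "minkowski_average A k = {(1 / real k) *\<^sub>R (\<Sum>i<k. a i) | a. \<forall>i<k. a i \<in> A}"

(* On a Euclidean space, norm is the Euclidean norm. For nonempty compact A the supremum and
   infimum range over nonempty bounded sets of reals, so SUP and INF are the usual ones;
   otherwise the value carries no meaning. *)
definition hull_dist :: "'a::euclidean_space set \<Rightarrow> real" where
  "hull_dist A = (SUP x\<in>convex hull A. INF y\<in>A. norm (x - y))"

end

theory Submission
  imports Defs
begin

text \<open>
  Write \<open>n\<close> for the dimension and \<open>d\<close> for the Hausdorff distance from \<open>A\<close> to its convex hull, and
  take \<open>x\<close> in the hull. The hull of the average lies in the hull of \<open>A\<close>, so it is enough to find a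
  point of the average close to \<open>x\<close>. It is sought in the form \<open>a/n + (1 - 1/n) q\<close> with \<open>a\<close>, \<open>q\<close> in
  \<open>A\<close>. If \<open>x = a/n + (1 - 1/n) y\<close> exactly, with \<open>a\<close> in \<open>A\<close> and \<open>y\<close> in the hull, choosing \<open>q\<close> within
  \<open>d\<close> of \<open>y\<close> costs only \<open>(1 - 1/n) d\<close>. Such a representation exists when \<open>x\<close> is a convex combination
  of at most \<open>n\<close> points of \<open>A\<close>, since one of the weights is then at least \<open>1/n\<close>
  (\<open>convex_hull_heavy_point\<close>); in general \<open>n + 1\<close> points are needed, and all weights may be smaller.

  The remedy is to use as one of the \<open>n + 1\<close> points a point \<open>p\<close> of \<open>A\<close> with \<open>|x - p| \<le> d\<close>
  (\<open>caratheodory_anchored\<close>): \<open>x = t p + (1 - t) w\<close>, where \<open>w\<close> is a combination of at most \<open>n\<close>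
  points of \<open>A\<close>. Put \<open>s = 1/(2 n - 1)\<close>.

  \<^item> If \<open>t \<le> 1/(2 n)\<close>, then \<open>x\<close> is close to \<open>w\<close>: \<open>|x - w| = t/(1 - t) |x - p| \<le> s d\<close>. Replacing
    \<open>x\<close> by \<open>w\<close> gives the error \<open>(1 - 1/n + s) d\<close>.
  \<^item> If \<open>t \<ge> 1/(2 n)\<close>, then \<open>x\<close> is so far from \<open>w\<close> that \<open>y = x - s (p - x)\<close> is still in the hull.
    Take \<open>a = p\<close> and \<open>q\<close> close to \<open>y\<close>: the displacement of \<open>y\<close> cancels a part of the error
    \<open>(x - p)/n\<close>, and the total error is at most \<open>(1 - (1 - 1/n) s) d\<close>.

  The threshold balances the two cases. With \<open>t/(1 - t)\<close> in place of \<open>s\<close>, the first bound grows with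
  \<open>t\<close> and the second decreases; they agree at \<open>t = 1/(2 n)\<close>, where \<open>t/(1 - t) = s\<close> and both are the
  constant of the theorem.
\<close>

text \<open>
  Caratheodory's theorem with one point prescribed: move the weights of a representation by \<open>n + 1\<close>
  points along an affine dependence of these points and \<open>p\<close> until the weight of a point other than
  \<open>p\<close> vanishes.
\<close>
lemma caratheodory_anchored:
  fixes A :: "'a::euclidean_space set" and p x :: 'a
  assumes "x \<in> convex hull A"
  obtains S where "finite S" "S \<subseteq> A" "S \<noteq> {}" "card S \<le> DIM('a)" "x \<in> convex hull (insert p S)"
proof -
  obtain S where S: "finite S" "S \<subseteq> A" "card S \<le> DIM('a) + 1" "x \<in> convex hull S"
    using assms unfolding caratheodory[of A] convex_hull_finite by (auto simp: convex_hull_finite)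
  consider "card S \<le> DIM('a)" | "card S = DIM('a) + 1" "p \<in> S" | "card S = DIM('a) + 1" "p \<notin> S"
    using S(3) by linarith
  then show thesis
  proof cases
    case 1
    have "S \<noteq> {}" using S(4) by auto
    moreover have "x \<in> convex hull (insert p S)"
      using S(4) hull_mono[of S "insert p S"] by blast
    ultimately show thesis using that S 1 by blast
  next
    case 2
    have "card (S - {p}) = DIM('a)" using 2 S(1) by simp
    moreover from this have "S - {p} \<noteq> {}" by (metis DIM_positive card.empty less_irrefl)
    moreover have "insert p (S - {p}) = S" using 2 by blast
    ultimately show thesis
      using that[of "S - {p}"] S by (metis Diff_subset finite_Diff le_refl subset_trans)
  next
    case 3
    let ?T = "insert p S"
    have finT: "finite ?T" using S(1) by simp
    have "affine_dependent ?T"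
      using affine_dependent_biggerset[OF finT] 3 S(1) by simp
    then obtain U where U: "sum U ?T = 0" "\<exists>v\<in>?T. U v \<noteq> 0" "(\<Sum>v\<in>?T. U v *\<^sub>R v) = 0"
      using affine_dependent_explicit_finite[OF finT] by blast
    \<comment> \<open>With a nonpositive coefficient at \<open>p\<close>, moving along the dependence never exhausts
      the weight of \<open>p\<close>, so the point dropped below is one of the others.\<close>
    define \<sigma> :: real where "\<sigma> = (if U p \<le> 0 then 1 else -1)"
    define u where "u v = \<sigma> * U v" for v
    have \<sigma>: "\<sigma> \<noteq> 0" by (simp add: \<sigma>_def)
    have up: "u p \<le> 0" by (simp add: u_def \<sigma>_def)
    have u: "sum u ?T = 0" "\<exists>v\<in>?T. u v \<noteq> 0" "(\<Sum>v\<in>?T. u v *\<^sub>R v) = 0"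
    proof -
      show "sum u ?T = 0" unfolding u_def sum_distrib_left[symmetric] U(1) by simp
      show "\<exists>v\<in>?T. u v \<noteq> 0" using U(2) \<sigma> by (simp add: u_def)
      show "(\<Sum>v\<in>?T. u v *\<^sub>R v) = 0"
        unfolding u_def scaleR_scaleR[symmetric] scaleR_sum_right[symmetric] U(3) by simp
    qed
    have "\<exists>v\<in>?T. u v > 0"
    proof (rule ccontr)
      assume "\<not> ?thesis"
      then have "\<forall>v\<in>?T. - u v \<ge> 0" by force
      moreover have "sum (\<lambda>v. - u v) ?T = 0" using u(1) by (simp only: sum_negf)
      ultimately have "\<forall>v\<in>?T. - u v = 0" using sum_nonneg_eq_0_iff[OF finT, of "\<lambda>v. - u v"] by blast
      then show False using u(2) by force
    qed
    then obtain v0 where v0: "v0 \<in> S" "u v0 > 0" using up by auto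
    obtain c where c: "\<forall>v\<in>S. 0 \<le> c v" "sum c S = 1" "(\<Sum>v\<in>S. c v *\<^sub>R v) = x"
      using S(4) unfolding convex_hull_finite[OF S(1)] by blast
    define P where "P = {v\<in>S. u v > 0}"
    have P: "finite P" "P \<noteq> {}" using S(1) v0 unfolding P_def by auto
    obtain r where r: "r \<in> P" "\<And>v. v \<in> P \<Longrightarrow> c r / u r \<le> c v / u v"
      using arg_min_if_finite(1)[OF P, of "\<lambda>v. c v / u v"] arg_min_least[OF P, of _ "\<lambda>v. c v / u v"]
      by blast
    define \<alpha> where "\<alpha> = c r / u r"
    define e where "e v = (if v = p then 0 else c v) - \<alpha> * u v" for v
    have rS: "r \<in> S" "u r > 0" using r(1) by (auto simp: P_def)
    have rp: "r \<noteq> p" using rS 3 by blast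
    have \<alpha>: "\<alpha> \<ge> 0" using c rS by (simp add: \<alpha>_def)
    have er: "e r = 0" using rS rp by (simp add: e_def \<alpha>_def)
    have e0: "e v \<ge> 0" if "v \<in> ?T" for v
    proof (cases "v = p")
      case True
      then show ?thesis using \<alpha> up by (simp add: e_def mult_nonneg_nonpos)
    next
      case False
      then have vS: "v \<in> S" using that by simp
      show ?thesis
      proof (cases "u v > 0")
        case True
        then have "\<alpha> \<le> c v / u v" using r(2) vS by (simp add: \<alpha>_def P_def)
        then show ?thesis using True False by (simp add: e_def field_simps)
      next
        case neg: False
        then have "\<alpha> * u v \<le> 0" using \<alpha> by (simp add: mult_nonneg_nonpos)
        then show ?thesis using False c(1) vS by (simp add: e_def) (smt (verit))
      qed
    qed
    have drop: "(\<Sum>v\<in>S. (if v = p then 0 else c v)) = 1"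
      "(\<Sum>v\<in>S. (if v = p then 0 else c v) *\<^sub>R v) = x"
      unfolding c(2,3)[symmetric] using 3(2) by (intro sum.cong; auto)+
    have "sum e ?T = 1"
    proof -
      have "sum e ?T = (\<Sum>v\<in>?T. (if v = p then 0 else c v)) - \<alpha> * sum u ?T"
        unfolding e_def sum_subtractf sum_distrib_left ..
      then show ?thesis using u(1) drop(1) S(1) 3(2) by simp
    qed
    moreover have "(\<Sum>v\<in>?T. e v *\<^sub>R v) = x"
    proof -
      have "(\<Sum>v\<in>?T. e v *\<^sub>R v)
          = (\<Sum>v\<in>?T. (if v = p then 0 else c v) *\<^sub>R v) - \<alpha> *\<^sub>R (\<Sum>v\<in>?T. u v *\<^sub>R v)"
        unfolding e_def scaleR_left_diff_distrib sum_subtractf scaleR_sum_right scaleR_scaleR ..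
      then show ?thesis using u(3) drop(2) S(1) 3(2) by simp
    qed
    moreover have T: "?T = insert r (insert p (S - {r}))" using rS by blast
    moreover have "r \<notin> insert p (S - {r})" "finite (insert p (S - {r}))" using rp S(1) by auto
    note drop_r = sum.insert[OF this(2,1)]
    ultimately have "sum e (insert p (S - {r})) = 1"
      "(\<Sum>v\<in>insert p (S - {r}). e v *\<^sub>R v) = x"
      unfolding T drop_r er by simp_all
    then have hull: "x \<in> convex hull (insert p (S - {r}))"
      using e0 S(1) unfolding convex_hull_finite[OF finite_insert[THEN iffD2, OF finite_Diff[OF S(1)]]]
      by blast
    have card: "card (S - {r}) = DIM('a)" using rS S(1) 3 by simp
    then have "S - {r} \<noteq> {}" by (metis DIM_positive card.empty less_irrefl)
    then show thesis using that[of "S - {r}"] hull card S by auto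
  qed
qed

text \<open>
  By pigeonhole some weight is at least \<open>1/m\<close>; take exactly \<open>1/m\<close> of it away and renormalise the rest.
\<close>
lemma convex_hull_heavy_point:
  fixes S :: "'a::real_vector set"
  assumes S: "finite S" "card S \<le> m" and m: "m \<ge> 2" and w: "w \<in> convex hull S"
  obtains a y where "a \<in> S" "y \<in> convex hull S"
    "w = (1 / real m) *\<^sub>R a + (1 - 1 / real m) *\<^sub>R y"
proof -
  obtain u where u: "\<forall>v\<in>S. 0 \<le> u v" "sum u S = 1" "(\<Sum>v\<in>S. u v *\<^sub>R v) = w"
    using w unfolding convex_hull_finite[OF S(1)] by blast
  have "S \<noteq> {}" using w by auto
  have "\<exists>a\<in>S. u a \<ge> 1 / real m"
  proof (rule ccontr)
    assume "\<not> ?thesis"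
    then have "sum u S < (\<Sum>v\<in>S. 1 / real m)"
      using S(1) \<open>S \<noteq> {}\<close> by (intro sum_strict_mono) auto
    also have "\<dots> \<le> 1" using S m by (simp add: field_simps)
    finally show False using u by simp
  qed
  then obtain a where a: "a \<in> S" "u a \<ge> 1 / real m" by blast
  let ?k = "1 - 1 / real m"
  have k: "?k > 0" using m by simp
  define e where "e v = (u v - (if v = a then 1 / real m else 0)) / ?k" for v
  define y where "y = (\<Sum>v\<in>S. e v *\<^sub>R v)"
  have "\<forall>v\<in>S. e v \<ge> 0" using u a k by (auto simp: e_def)
  moreover have "sum e S = 1"
    using u(2) a(1) S(1) k m
    by (simp add: e_def sum_divide_distrib[symmetric] sum_subtractf del: diff_gt_0_iff_gt)
  ultimately have "y \<in> convex hull S"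
    unfolding convex_hull_finite[OF S(1)] y_def by blast
  moreover have "?k *\<^sub>R y = w - (1 / real m) *\<^sub>R a"
  proof -
    have "?k *\<^sub>R y = (\<Sum>v\<in>S. u v *\<^sub>R v - (if v = a then 1 / real m else 0) *\<^sub>R v)"
      unfolding y_def scaleR_sum_right using k
      by (intro sum.cong) (auto simp: e_def scaleR_left_diff_distrib)
    also have "\<dots> = w - (\<Sum>v\<in>S. if v = a then (1 / real m) *\<^sub>R v else 0)"
      unfolding sum_subtractf u(3) by (intro arg_cong[of _ _ "(-) w"] sum.cong) auto
    finally show ?thesis using a(1) S(1) by simp
  qed
  ultimately show thesis using that a(1) by simp
qed

lemma one_and_rest_in_minkowski_average:
  assumes "a \<in> A" "q \<in> A" "n > 0"
  shows "(1 / real n) *\<^sub>R a + (1 - 1 / real n) *\<^sub>R q \<in> minkowski_average A n"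
proof -
  obtain m where n: "n = Suc m" using assms(3) gr0_implies_Suc by blast
  define f where "f i = (if i = 0 then a else q)" for i :: nat
  have "(\<Sum>i<n. f i) = a + real m *\<^sub>R q"
    unfolding n sum.lessThan_Suc_shift by (simp add: f_def sum_constant_scaleR)
  moreover have "(1 / real n) *\<^sub>R (a + real m *\<^sub>R q)
      = (1 / real n) *\<^sub>R a + (1 - 1 / real n) *\<^sub>R q"
    by (simp add: n scaleR_add_right field_simps)
  moreover have "\<forall>i<n. f i \<in> A" using assms by (simp add: f_def)
  ultimately show ?thesis unfolding minkowski_average_def by force
qed

lemma minkowski_average_subset_convex_hull:
  assumes "n > 0"
  shows "minkowski_average A n \<subseteq> convex hull A"
proof
  fix z assume "z \<in> minkowski_average A n"
  then obtain f where f: "z = (1 / real n) *\<^sub>R (\<Sum>i<n. f i)" "\<forall>i<n. f i \<in> A"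
    unfolding minkowski_average_def by blast
  have "(\<Sum>i<n. (1 / real n) *\<^sub>R f i) \<in> convex hull A"
    using f(2) assms by (intro convex_sum) (auto intro: hull_inc)
  then show "z \<in> convex hull A" using f(1) by (simp add: scaleR_sum_right)
qed

text \<open>
  The argument splits on whether the weight \<open>t\<close> of a point \<open>p\<close> of \<open>A\<close> near \<open>x\<close> is small, so that \<open>x\<close>
  is almost a combination of \<open>n\<close> points, or large, so that \<open>x\<close> can be moved away from \<open>p\<close> in the hull.
\<close>
lemma exists_near_point_of_minkowski_average:
  fixes A :: "'a::euclidean_space set" and n :: nat
  assumes near: "\<And>y. y \<in> convex hull A \<Longrightarrow> \<exists>q\<in>A. norm (y - q) \<le> d"
    and n: "n = DIM('a)" "n \<ge> 2" and x: "x \<in> convex hull A"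
  shows "\<exists>z\<in>minkowski_average A n.
    norm (x - z) \<le> (1 - (real n - 1) / (real n * (2 * real n - 1))) * d"
proof -
  define N where "N = real n"
  have N: "N \<ge> 2" using n by (simp add: N_def)
  define s where "s = 1 / (2 * N - 1)"
  have s: "s > 0" "(N - 1) * s \<le> 1" "(1 + s) = 2 * N * s" using N by (auto simp: s_def field_simps)
  have const: "1 - (real n - 1) / (real n * (2 * real n - 1)) = 1 - (1 - 1 / N) * s"
    "(1 - 1 / N) + s = 1 - (1 - 1 / N) * s"
    using N by (auto simp: s_def N_def field_simps)
  obtain p where p: "p \<in> A" "norm (x - p) \<le> d" using near[OF x] by blast
  obtain S where S: "finite S" "S \<subseteq> A" "S \<noteq> {}" "card S \<le> n" "x \<in> convex hull (insert p S)"
    using caratheodory_anchored[OF x, of p] n(1) by blast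
  obtain t t' w where t: "t \<ge> 0" "t' \<ge> 0" "t + t' = 1" and w: "w \<in> convex hull S"
    and xw0: "x = t *\<^sub>R p + t' *\<^sub>R w"
    using S(5) unfolding convex_hull_insert[OF S(3)] by blast
  have xw: "x = t *\<^sub>R p + (1 - t) *\<^sub>R w" "t \<le> 1" using t xw0 by (auto simp: eq_diff_eq')
  have hullS: "convex hull S \<subseteq> convex hull A" using S(2) by (rule hull_mono)
  have gap: "norm ((1 - 1 / N) *\<^sub>R (y - q)) \<le> (1 - 1 / N) * d" if "norm (y - q) \<le> d" for y q :: 'a
    using that N by (simp add: mult_left_mono)
  show ?thesis
  proof (cases "t \<le> 1 / (2 * N)")
    case True
    obtain a y where ay: "a \<in> S" "y \<in> convex hull S" "w = (1 / N) *\<^sub>R a + (1 - 1 / N) *\<^sub>R y"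
      using convex_hull_heavy_point[OF S(1,4) n(2) w] unfolding N_def by blast
    obtain q where q: "q \<in> A" "norm (y - q) \<le> d" using near ay(2) hullS by blast
    let ?z = "(1 / N) *\<^sub>R a + (1 - 1 / N) *\<^sub>R q"
    have z: "?z \<in> minkowski_average A n"
      using one_and_rest_in_minkowski_average[of a A q n] ay(1) S(2) q(1) n unfolding N_def by auto
    have t1: "t < 1" using True N by (smt (verit) divide_less_eq_1)
    have "t \<le> s * (1 - t)"
    proof -
      have "t * (1 + s) \<le> s"
        using True N s(1) unfolding s(3) by (simp add: field_simps)
      then show ?thesis by (simp add: algebra_simps)
    qed
    moreover have "norm (x - p) = (1 - t) * norm (p - w)"
    proof -
      have "x - p = (1 - t) *\<^sub>R (w - p)" unfolding xw(1) by (simp add: algebra_simps)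
      then show ?thesis using t1 by (simp add: norm_minus_commute)
    qed
    moreover have "norm (x - w) = t * norm (p - w)"
    proof -
      have "x - w = t *\<^sub>R (p - w)" unfolding xw(1) by (simp add: algebra_simps)
      then show ?thesis using t by simp
    qed
    ultimately have "norm (x - w) \<le> s * norm (x - p)"
      by (metis mult.assoc mult_right_mono norm_ge_zero)
    also have "\<dots> \<le> s * d" using p(2) s(1) by simp
    finally have "norm (x - w) \<le> s * d" .
    moreover have "x - ?z = (x - w) + (1 - 1 / N) *\<^sub>R (y - q)"
      unfolding ay(3) by (simp add: algebra_simps)
    ultimately have "norm (x - ?z) \<le> s * d + (1 - 1 / N) * d"
      using gap[OF q(2)] by (metis add_mono norm_triangle_le)
    also have "\<dots> = (1 - (1 - 1 / N) * s) * d"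
      unfolding const(2)[symmetric] by (simp add: algebra_simps)
    finally show ?thesis using z unfolding const(1) by blast
  next
    case False
    \<comment> \<open>Step from \<open>x\<close> away from \<open>p\<close>; the weight of \<open>p\<close> in the result, \<open>(1 + s) t - s\<close>, stays nonnegative.\<close>
    define y where "y = x + s *\<^sub>R (x - p)"
    have "s \<le> (1 + s) * t" using False N s(1) unfolding s(3) by (simp add: field_simps)
    moreover have "y = ((1 + s) * t - s) *\<^sub>R p + ((1 + s) * (1 - t)) *\<^sub>R w"
      unfolding y_def xw(1) by (simp add: algebra_simps)
    moreover have "p \<in> convex hull A" "w \<in> convex hull A"
      using p(1) w hullS by (auto intro: hull_inc)
    moreover have "(1 + s) * t - s + (1 + s) * (1 - t) = 1" by (simp add: algebra_simps)
    ultimately have "y \<in> convex hull A"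
      using convexD[OF convex_convex_hull, of p A w "(1 + s) * t - s" "(1 + s) * (1 - t)"] xw(2) s(1)
      by simp
    then obtain q where q: "q \<in> A" "norm (y - q) \<le> d" using near by blast
    let ?z = "(1 / N) *\<^sub>R p + (1 - 1 / N) *\<^sub>R q"
    have z: "?z \<in> minkowski_average A n"
      using one_and_rest_in_minkowski_average[of p A q n] p(1) q(1) n unfolding N_def by auto
    define r where "r = 1 / N - (1 - 1 / N) * s"
    have r: "r \<ge> 0" using s(2) N by (simp add: r_def field_simps)
    have "x - ?z = r *\<^sub>R (x - p) + (1 - 1 / N) *\<^sub>R (y - q)"
      unfolding y_def r_def by (simp add: algebra_simps)
    moreover have "norm (r *\<^sub>R (x - p)) \<le> r * d"
      using r p(2) by (simp add: mult_left_mono)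
    ultimately have "norm (x - ?z) \<le> r * d + (1 - 1 / N) * d"
      using gap[OF q(2)] by (metis add_mono norm_triangle_le)
    also have "\<dots> = (1 - (1 - 1 / N) * s) * d"
      unfolding r_def by (simp add: algebra_simps)
    finally show ?thesis using z unfolding const(1) by blast
  qed
qed

lemma hull_dist_attained:
  fixes A :: "'a::euclidean_space set"
  assumes A: "compact A" "A \<noteq> {}" and y: "y \<in> convex hull A"
  shows "\<exists>q\<in>A. norm (y - q) \<le> hull_dist A"
proof -
  have inf: "(INF q\<in>A. norm (z - q)) = infdist z A" for z
    using A(2) by (simp add: infdist_notempty dist_norm)
  have "bdd_above ((\<lambda>z. infdist z A) ` (convex hull A))"
    using A by (intro bounded_imp_bdd_above compact_imp_bounded compact_continuous_image
        continuous_intros compact_convex_hull)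
  then have "infdist y A \<le> hull_dist A"
    unfolding hull_dist_def inf using y by (rule cSUP_upper[rotated])
  moreover obtain q where "q \<in> A" "infdist y A = dist y q"
    using infdist_attains_inf[of A y] A compact_imp_closed by blast
  ultimately show ?thesis by (metis dist_norm)
qed

lemma hull_dist_le:
  fixes A :: "'a::euclidean_space set"
  assumes "A \<noteq> {}" and "\<And>x. x \<in> convex hull A \<Longrightarrow> \<exists>z\<in>A. norm (x - z) \<le> c"
  shows "hull_dist A \<le> c"
  unfolding hull_dist_def
proof (rule cSUP_least)
  show "convex hull A \<noteq> {}" using assms(1) by simp
  fix x assume "x \<in> convex hull A"
  then obtain z where "z \<in> A" "norm (x - z) \<le> c" using assms(2) by blast
  then show "(INF y\<in>A. norm (x - y)) \<le> c"
    by (intro cINF_lower2[where x = z]) (auto intro!: bdd_belowI[of _ 0])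
qed

theorem theorem1p4:
  fixes A :: "(real ^ 'n) set" and n :: nat
  assumes "n = CARD('n)" and "n \<ge> 2" and "A \<noteq> {}" and "compact A"
  shows "hull_dist (minkowski_average A n)
    \<le> (1 - (real n - 1) / (real n * (2 * real n - 1))) * hull_dist A"
proof (rule hull_dist_le)
  have n: "n = DIM(real ^ 'n)" "n > 0" using assms by simp_all
  show "minkowski_average A n \<noteq> {}"
    using one_and_rest_in_minkowski_average[of _ A _ n] assms(3) n(2) by blast
  fix x assume "x \<in> convex hull (minkowski_average A n)"
  moreover have "convex hull (minkowski_average A n) \<subseteq> convex hull A"
    by (intro hull_minimal minkowski_average_subset_convex_hull n(2) convex_convex_hull)
  ultimately show "\<exists>z\<in>minkowski_average A n.
      norm (x - z) \<le> (1 - (real n - 1) / (real n * (2 * real n - 1))) * hull_dist A"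
    using exists_near_point_of_minkowski_average[OF hull_dist_attained[OF assms(4,3)] n(1) assms(2)]
    by blast
qed

end
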